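(* $PT_3\cong\mathbb{Z}$ and $PT_4\cong F_7$, where $F_7$ is the free group of rank 7.
   Context: For an integer $n\ge 2$, the twin group $T_n$ is the group generated by $s_1,\dots,s_{n-1}$ with defining relations $s_i^2=1$ for $1\le i\le n-1$ and $s_is_j=s_js_i$ for $|i-j|\ge 2$. The pure twin group $PT_n$ is the kernel of the homomorphism $\pi:T_n\to S_n$ to the symmetric group on $\{1,\dots,n\}$ that maps $s_i$ to the transposition $(i,i+1)$ for $1\le i\le n-1$. *)

theory Defs
  imports "HOL-Algebra.Sym_Groups" "HOL-Algebra.Elementary_Groups"
begin

section \<open>Groups given by generators and relations\<close>

text \<open>The letter \<open>(x, True)\<close> stands for the generator \<open>x\<close> and \<open>(x, False)\<close> for its formal inverse.
  A relation \<open>u = v\<close> is the pair of words \<open>(u, v)\<close>.\<close>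

type_synonym 'a gword = "('a \<times> bool) list"

definition gwords :: "'a set \<Rightarrow> 'a gword set" where
  "gwords X = lists (X \<times> UNIV)"

inductive gword_cong :: "'a set \<Rightarrow> ('a gword \<times> 'a gword) set \<Rightarrow> 'a gword \<Rightarrow> 'a gword \<Rightarrow> bool"
  for X R where
  refl: "w \<in> gwords X \<Longrightarrow> gword_cong X R w w"
| sym: "gword_cong X R u v \<Longrightarrow> gword_cong X R v u"
| trans: "gword_cong X R u v \<Longrightarrow> gword_cong X R v w \<Longrightarrow> gword_cong X R u w"
| append: "gword_cong X R u u' \<Longrightarrow> gword_cong X R v v' \<Longrightarrow> gword_cong X R (u @ v) (u' @ v')"
| cancel: "x \<in> X \<Longrightarrow> gword_cong X R [(x, b), (x, \<not> b)] []"
| relation: "(u, v) \<in> R \<Longrightarrow> u \<in> gwords X \<Longrightarrow> v \<in> gwords X \<Longrightarrow> gword_cong X R u v"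

definition gword_rel :: "'a set \<Rightarrow> ('a gword \<times> 'a gword) set \<Rightarrow> ('a gword \<times> 'a gword) set" where
  "gword_rel X R = {(u, v). gword_cong X R u v}"

definition presented_group ::
  "'a set \<Rightarrow> ('a gword \<times> 'a gword) set \<Rightarrow> 'a gword set monoid" where
  "presented_group X R =
    \<lparr> carrier = gwords X // gword_rel X R,
      mult = (\<lambda>A B. \<Union>a\<in>A. \<Union>b\<in>B. gword_rel X R `` {a @ b}),
      one = gword_rel X R `` {[]} \<rparr>"

definition presented_gen :: "'a set \<Rightarrow> ('a gword \<times> 'a gword) set \<Rightarrow> 'a \<Rightarrow> 'a gword set" where
  "presented_gen X R x = gword_rel X R `` {[(x, True)]}"

definition gword_eval :: "('b, 'm) monoid_scheme \<Rightarrow> ('a \<Rightarrow> 'b) \<Rightarrow> 'a gword \<Rightarrow> 'b" where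
  "gword_eval G f w =
    foldr (\<lambda>(x, b) g. (if b then f x else inv\<^bsub>G\<^esub> f x) \<otimes>\<^bsub>G\<^esub> g) w \<one>\<^bsub>G\<^esub>"

text \<open>The homomorphism from a presented group that extends \<open>f\<close>. The image below is a singleton
  whenever \<open>f\<close> respects the relations; see \<open>presented_hom\<close> and \<open>presented_hom_unique\<close>.\<close>

definition presented_hom :: "('b, 'm) monoid_scheme \<Rightarrow> ('a \<Rightarrow> 'b) \<Rightarrow> 'a gword set \<Rightarrow> 'b" where
  "presented_hom G f A = the_elem (gword_eval G f ` A)"

definition free_group :: "'a set \<Rightarrow> 'a gword set monoid" where
  "free_group X = presented_group X {}"


section \<open>Twin groups\<close>

definition twin_relations :: "nat \<Rightarrow> (nat gword \<times> nat gword) set" where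
  "twin_relations n =
    {([(i, True), (i, True)], []) | i. i \<in> {1..n - 1}} \<union>
    {([(i, True), (j, True)], [(j, True), (i, True)]) | i j.
        i \<in> {1..n - 1} \<and> j \<in> {1..n - 1} \<and> \<bar>int i - int j\<bar> \<ge> 2}"

definition twin_group :: "nat \<Rightarrow> nat gword set monoid" where
  "twin_group n = presented_group {1..n - 1} (twin_relations n)"

definition twin_gen :: "nat \<Rightarrow> nat \<Rightarrow> nat gword set" where
  "twin_gen n i = presented_gen {1..n - 1} (twin_relations n) i"

definition twin_perm :: "nat \<Rightarrow> nat gword set \<Rightarrow> nat \<Rightarrow> nat" where
  "twin_perm n = presented_hom (sym_group n) (\<lambda>i. transpose i (i + 1))"

definition pure_twin_group :: "nat \<Rightarrow> nat gword set monoid" where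
  "pure_twin_group n =
    (twin_group n)\<lparr>carrier := kernel (twin_group n) (sym_group n) (twin_perm n)\<rparr>"


section \<open>Basic properties\<close>

lemma gwords_simps [simp]:
  "[] \<in> gwords X"
  "(x, b) # w \<in> gwords X \<longleftrightarrow> x \<in> X \<and> w \<in> gwords X"
  "u @ v \<in> gwords X \<longleftrightarrow> u \<in> gwords X \<and> v \<in> gwords X"
  by (auto simp: gwords_def)

lemma gword_cong_in: "gword_cong X R u v \<Longrightarrow> u \<in> gwords X \<and> v \<in> gwords X"
  by (induction rule: gword_cong.induct) auto

lemma equiv_gword_rel: "equiv (gwords X) (gword_rel X R)"
  unfolding gword_rel_def
  by (rule equivI)
     (auto simp: refl_on_def sym_def trans_def dest: gword_cong_in
           intro: gword_cong.refl gword_cong.sym gword_cong.trans)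

lemma presented_mult:
  assumes "u \<in> gwords X" "v \<in> gwords X"
  shows "(gword_rel X R `` {u}) \<otimes>\<^bsub>presented_group X R\<^esub> (gword_rel X R `` {v})
    = gword_rel X R `` {u @ v}"
proof -
  have c: "congruent2 (gword_rel X R) (gword_rel X R) (\<lambda>a b. gword_rel X R `` {a @ b})"
    by (rule congruent2I') (auto simp: gword_rel_def intro: gword_cong.intros)
  show ?thesis
    using UN_equiv_class2[OF equiv_gword_rel equiv_gword_rel c assms]
    by (simp add: presented_group_def)
qed

lemma presented_carrierE:
  assumes "A \<in> carrier (presented_group X R)"
  obtains u where "u \<in> gwords X" "A = gword_rel X R `` {u}"
  using assms by (auto simp: presented_group_def elim: quotientE)

lemma presented_carrierI:
  "u \<in> gwords X \<Longrightarrow> gword_rel X R `` {u} \<in> carrier (presented_group X R)"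
  by (simp add: presented_group_def quotientI)

lemma presented_one: "\<one>\<^bsub>presented_group X R\<^esub> = gword_rel X R `` {[]}"
  by (simp add: presented_group_def)

lemma gword_left_inverse:
  assumes "w \<in> gwords X"
  shows "\<exists>v\<in>gwords X. gword_cong X R (v @ w) []"
  using assms
proof (induction w)
  case Nil
  then show ?case by (intro bexI[of _ "[]"]) (auto intro: gword_cong.refl)
next
  case (Cons l w)
  obtain x b where l: "l = (x, b)" by (cases l)
  with Cons obtain v where x: "x \<in> X" and w: "w \<in> gwords X"
    and v: "v \<in> gwords X" "gword_cong X R (v @ w) []" by auto
  have "gword_cong X R [(x, \<not> b), (x, \<not> \<not> b)] []"
    using x by (rule gword_cong.cancel)
  then have "gword_cong X R ([(x, \<not> b), (x, b)] @ w) ([] @ w)"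
    using w by (intro gword_cong.append gword_cong.refl) auto
  then have "gword_cong X R (v @ ([(x, \<not> b), (x, b)] @ w)) (v @ ([] @ w))"
    by (rule gword_cong.append[OF gword_cong.refl[OF v(1)]])
  then have "gword_cong X R ((v @ [(x, \<not> b)]) @ l # w) []"
    using gword_cong.trans[OF _ v(2)] by (simp add: l)
  with x v show ?case by (intro bexI[of _ "v @ [(x, \<not> b)]"]) auto
qed

lemma group_presented_group: "group (presented_group X R)"
proof (rule groupI)
  fix A assume "A \<in> carrier (presented_group X R)"
  then obtain u where u: "u \<in> gwords X" "A = gword_rel X R `` {u}"
    by (rule presented_carrierE)
  show "\<one>\<^bsub>presented_group X R\<^esub> \<otimes>\<^bsub>presented_group X R\<^esub> A = A"
    by (simp add: presented_one presented_mult u)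
  obtain v where v: "v \<in> gwords X" "gword_cong X R (v @ u) []"
    using gword_left_inverse[OF u(1)] by blast
  then have "gword_rel X R `` {v @ u} = gword_rel X R `` {[]}"
    by (intro equiv_class_eq[OF equiv_gword_rel]) (simp add: gword_rel_def)
  then show "\<exists>B\<in>carrier (presented_group X R).
      B \<otimes>\<^bsub>presented_group X R\<^esub> A = \<one>\<^bsub>presented_group X R\<^esub>"
    by (intro bexI[of _ "gword_rel X R `` {v}"])
       (simp_all add: presented_mult presented_one presented_carrierI u v)
qed (auto simp: presented_one presented_mult presented_carrierI elim!: presented_carrierE)

lemma presented_gen_closed:
  "x \<in> X \<Longrightarrow> presented_gen X R x \<in> carrier (presented_group X R)"
  by (simp add: presented_gen_def presented_carrierI)

context group
begin

lemma gword_eval_simps [simp]: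
  "gword_eval G f [] = \<one>"
  "gword_eval G f ((x, b) # w) = (if b then f x else inv f x) \<otimes> gword_eval G f w"
  by (simp_all add: gword_eval_def)

lemma gword_eval_closed:
  assumes "f ` X \<subseteq> carrier G" "w \<in> gwords X"
  shows "gword_eval G f w \<in> carrier G"
  using assms(2)
proof (induction w)
  case (Cons l w)
  with assms(1) show ?case by (cases l) auto
qed simp

lemma gword_eval_append:
  assumes "f ` X \<subseteq> carrier G" "u \<in> gwords X" "v \<in> gwords X"
  shows "gword_eval G f (u @ v) = gword_eval G f u \<otimes> gword_eval G f v"
  using assms(2)
proof (induction u)
  case Nil
  with gword_eval_closed[OF assms(1,3)] show ?case by simp
next
  case (Cons l u)
  then obtain x b where l: "l = (x, b)" "x \<in> X" "u \<in> gwords X" by (cases l) auto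
  then have "f x \<in> carrier G" using assms(1) by auto
  with Cons l gword_eval_closed[OF assms(1) l(3)] gword_eval_closed[OF assms(1,3)]
  show ?case by (simp add: m_assoc)
qed

context
  fixes f :: "'c \<Rightarrow> 'a" and X R
  assumes f: "f ` X \<subseteq> carrier G"
    and R: "\<And>u v. (u, v) \<in> R \<Longrightarrow> gword_eval G f u = gword_eval G f v"
begin

lemma gword_eval_cong: "gword_cong X R u v \<Longrightarrow> gword_eval G f u = gword_eval G f v"
proof (induction rule: gword_cong.induct)
  case (append u u' v v')
  then show ?case
    using gword_eval_append[OF f] gword_cong_in by metis
next
  case (cancel x b)
  then have "f x \<in> carrier G" using f by auto
  then show ?case by simp
qed (auto simp: R)

lemma presented_hom_class:
  assumes "w \<in> gwords X"
  shows "presented_hom G f (gword_rel X R `` {w}) = gword_eval G f w"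
proof -
  have "gword_eval G f ` (gword_rel X R `` {w}) = {gword_eval G f w}"
    using assms by (auto simp: gword_rel_def image_def dest: gword_eval_cong
        intro: exI[of _ w] gword_cong.refl)
  then show ?thesis by (simp add: presented_hom_def)
qed

lemma presented_hom: "presented_hom G f \<in> hom (presented_group X R) G"
proof (rule homI)
  fix A B assume "A \<in> carrier (presented_group X R)" "B \<in> carrier (presented_group X R)"
  then obtain u v where "u \<in> gwords X" "A = gword_rel X R `` {u}"
    "v \<in> gwords X" "B = gword_rel X R `` {v}" by (auto elim!: presented_carrierE)
  then show "presented_hom G f A \<in> carrier G"
    and "presented_hom G f (A \<otimes>\<^bsub>presented_group X R\<^esub> B)
      = presented_hom G f A \<otimes> presented_hom G f B"
    by (simp_all add: presented_hom_class presented_mult gword_eval_closed[OF f]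
        gword_eval_append[OF f])
qed

lemma presented_hom_gen: "x \<in> X \<Longrightarrow> presented_hom G f (presented_gen X R x) = f x"
  using f by (auto simp: presented_gen_def presented_hom_class)

lemma presented_hom_unique:
  assumes h: "h \<in> hom (presented_group X R) G"
    and gen: "\<And>x. x \<in> X \<Longrightarrow> h (presented_gen X R x) = f x"
    and A: "A \<in> carrier (presented_group X R)"
  shows "h A = presented_hom G f A"
proof -
  let ?P = "presented_group X R" and ?c = "\<lambda>w. gword_rel X R `` {w}"
  interpret P: group ?P by (rule group_presented_group)
  interpret h: group_hom ?P G h
    by unfold_locales (rule h)
  have letter: "h (?c [(x, b)]) = (if b then f x else inv f x)" if x: "x \<in> X" for x b
  proof (cases b)
    case True
    then show ?thesis using gen[OF x] by (simp add: presented_gen_def)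
  next
    case False
    have "?c [(x, False), (x, True)] = ?c []"
      using gword_cong.cancel[OF x, of R False]
      by (intro equiv_class_eq[OF equiv_gword_rel]) (simp add: gword_rel_def)
    then have "?c [(x, False)] \<otimes>\<^bsub>?P\<^esub> ?c [(x, True)] = \<one>\<^bsub>?P\<^esub>"
      using x by (simp add: presented_mult presented_one)
    then have "inv\<^bsub>?P\<^esub> (?c [(x, True)]) = ?c [(x, False)]"
      using x by (intro P.inv_equality presented_carrierI) auto
    then have "h (?c [(x, False)]) = inv h (?c [(x, True)])"
      using x h.hom_inv[of "?c [(x, True)]"] by (simp add: presented_carrierI)
    then show ?thesis using False gen[OF x] by (simp add: presented_gen_def)
  qed
  have "h (?c w) = gword_eval G f w" if "w \<in> gwords X" for w
    using that
  proof (induction w)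
    case Nil
    then show ?case using h.hom_one by (simp add: presented_one)
  next
    case (Cons l w)
    then obtain x b where l: "l = (x, b)" "x \<in> X" "w \<in> gwords X" by (cases l) auto
    have "h (?c (l # w)) = h (?c [(x, b)] \<otimes>\<^bsub>?P\<^esub> ?c w)"
      using l by (simp add: presented_mult)
    also have "\<dots> = h (?c [(x, b)]) \<otimes> h (?c w)"
      using l by (intro h.hom_mult presented_carrierI) auto
    finally show ?case using l letter Cons by simp
  qed
  with A show ?thesis by (auto simp: presented_hom_class elim!: presented_carrierE)
qed

end

end

lemma group_free_group: "group (free_group X)"
  by (simp add: free_group_def group_presented_group)

lemma group_twin_group: "group (twin_group n)"
  by (simp add: twin_group_def group_presented_group)

lemma transpose_in_sym_group:
  "i \<in> {1..n - 1} \<Longrightarrow> transpose i (i + 1) \<in> carrier (sym_group n)"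
  by (auto simp: sym_group_carrier intro!: permutes_swap_id)

lemma twin_relations_sym_group:
  assumes "(u, v) \<in> twin_relations n"
  shows "gword_eval (sym_group n) (\<lambda>i. transpose i (i + 1)) u
    = gword_eval (sym_group n) (\<lambda>i. transpose i (i + 1)) v"
proof -
  interpret S: group "sym_group n" by (rule sym_group_is_group)
  show ?thesis
    using assms
    by (auto simp: twin_relations_def sym_group_mult sym_group_one fun_eq_iff transpose_def)
qed

lemma twin_perm_hom: "twin_perm n \<in> hom (twin_group n) (sym_group n)"
  unfolding twin_perm_def twin_group_def
  using transpose_in_sym_group twin_relations_sym_group
  by (intro group.presented_hom[OF sym_group_is_group]) blast+

lemma twin_perm_gen:
  "i \<in> {1..n - 1} \<Longrightarrow> twin_perm n (twin_gen n i) = transpose i (i + 1)"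
  unfolding twin_perm_def twin_gen_def
  by (rule group.presented_hom_gen[OF sym_group_is_group _ twin_relations_sym_group])
     (use transpose_in_sym_group in blast)+

lemma group_pure_twin_group: "group (pure_twin_group n)"
proof -
  interpret group_hom "twin_group n" "sym_group n" "twin_perm n"
    by (intro group_hom.intro group_hom_axioms.intro group_twin_group sym_group_is_group
        twin_perm_hom)
  show ?thesis
    unfolding pure_twin_group_def
    by (rule subgroup.subgroup_is_group[OF subgroup_kernel G.group_axioms])
qed

end

(* Let T_n act on (states) x F, where the generator s_i moves the state q along an edge of a finite
   graph and multiplies the F-coordinate by the label of that edge. Choose a homomorphism
   psi : F -> T_n and a tree of words rep q such that s_i (rep q) = rep (s_i q) psi(label). Then
   every element of T_n has the form rep q * psi h, so psi maps onto PT_n once the permutations of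
   the words rep q are distinct from the identity off the base point; and psi is injective because
   psi h sends (base, 1) to (base, h).

   The states are the permutations p. Since T_3 = <s_1> * <s_2> and T_4 = (<s_1> x <s_3>) * <s_2>,
   the labels of all s_i with i \<noteq> 2 can be taken trivial, and F becomes the fundamental group of the
   graph obtained by collapsing the orbits of <s_1>, respectively <s_1, s_3>: a triangle for n = 3
   and an octahedron (6 vertices, 12 edges, so rank 7) for n = 4. *)

theory Submission
  imports Defs "HOL-Algebra.Bij"
begin

section \<open>Twin groups acting on Schreier coverings\<close>

lemma presented_group_generate:
  "carrier (presented_group X R) = generate (presented_group X R) (presented_gen X R ` X)"
proof
  interpret P: group "presented_group X R" by (rule group_presented_group)
  let ?c = "\<lambda>w. gword_rel X R `` {w}" and ?H = "presented_gen X R ` X"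
  have letter: "?c [(x, b)] \<in> generate (presented_group X R) ?H" if x: "x \<in> X" for x b
  proof (cases b)
    case True
    then show ?thesis using x by (auto simp: presented_gen_def intro: generate.incl)
  next
    case False
    have "?c [(x, False), (x, True)] = ?c []"
      using gword_cong.cancel[OF x, of R False]
      by (intro equiv_class_eq[OF equiv_gword_rel]) (simp add: gword_rel_def)
    then have "?c [(x, False)] \<otimes>\<^bsub>presented_group X R\<^esub> ?c [(x, True)] = \<one>\<^bsub>presented_group X R\<^esub>"
      using x by (simp add: presented_mult presented_one)
    then have "inv\<^bsub>presented_group X R\<^esub> (presented_gen X R x) = ?c [(x, False)]"
      using x unfolding presented_gen_def by (intro P.inv_equality presented_carrierI) auto
    then show ?thesis using x False generate.inv[of "presented_gen X R x" ?H "presented_group X R"] by simp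
  qed
  have "?c w \<in> generate (presented_group X R) ?H" if "w \<in> gwords X" for w
    using that
  proof (induction w)
    case Nil
    then show ?case using generate.one[of "presented_group X R"] by (simp add: presented_one)
  next
    case (Cons l w)
    then obtain x b where l: "l = (x, b)" "x \<in> X" "w \<in> gwords X" by (cases l) auto
    have "?c (l # w) = ?c [(x, b)] \<otimes>\<^bsub>presented_group X R\<^esub> ?c w"
      using l by (simp add: presented_mult)
    with l Cons.IH letter show ?case by (auto intro: generate.eng)
  qed
  then show "carrier (presented_group X R) \<subseteq> generate (presented_group X R) ?H"
    by (auto elim!: presented_carrierE)
  show "generate (presented_group X R) ?H \<subseteq> carrier (presented_group X R)"
    by (intro P.generate_incl) (auto intro: presented_gen_closed)
qed

lemma (in group) hom_agree_on_generate:
  assumes "group H" "f \<in> hom G H" "g \<in> hom G H" "A \<subseteq> carrier G"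
    and "\<And>a. a \<in> A \<Longrightarrow> f a = g a" "x \<in> generate G A"
  shows "f x = g x"
proof -
  interpret f: group_hom G H f
    by (intro group_hom.intro group_hom_axioms.intro is_group assms)
  interpret g: group_hom G H g
    by (intro group_hom.intro group_hom_axioms.intro is_group assms)
  show ?thesis
    using assms(6)
  proof induction
    case (inv h)
    then have "h \<in> carrier G" using assms(4) by auto
    with inv show ?case using assms(5) by simp
  next
    case (eng h1 h2)
    then show ?case using generate_in_carrier[OF assms(4)] by simp
  qed (use assms(5) in auto)
qed

section \<open>Positive words in the twin generators and their permutations\<close>

text \<open>Words carry no exponents: each generator of T_n is its own inverse, so products of this
  form exhaust the group.\<close>

definition twin_elt :: "nat \<Rightarrow> nat list \<Rightarrow> nat gword set" where
  "twin_elt n w = foldr (\<lambda>i g. twin_gen n i \<otimes>\<^bsub>twin_group n\<^esub> g) w \<one>\<^bsub>twin_group n\<^esub>"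

definition word_perm :: "nat list \<Rightarrow> nat \<Rightarrow> nat" where
  "word_perm w = foldr (\<lambda>i p. transpose i (i + 1) \<circ> p) w id"

lemma twin_elt_simps [simp]:
  "twin_elt n [] = \<one>\<^bsub>twin_group n\<^esub>"
  "twin_elt n (i # w) = twin_gen n i \<otimes>\<^bsub>twin_group n\<^esub> twin_elt n w"
  by (simp_all add: twin_elt_def)

lemma word_perm_simps [simp]:
  "word_perm [] = id"
  "word_perm (i # w) = transpose i (i + 1) \<circ> word_perm w"
  by (simp_all add: word_perm_def)

text \<open>Letters up to n - 1 fix every point outside \<open>{1..n}\<close>, so comparing two such
  permutations is a finite check.\<close>

lemma word_perm_eqI:
  assumes "set u \<subseteq> {1..n - 1}" "set v \<subseteq> {1..n - 1}"
    and eq: "\<And>x. x \<in> {1..n} \<Longrightarrow> word_perm u x = word_perm v x"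
  shows "word_perm u = word_perm v"
proof
  fix x
  have outside: "word_perm w x = x" if "set w \<subseteq> {1..n - 1}" "x \<notin> {1..n}" for w
    using that by (induction w) (auto simp: transpose_def)
  show "word_perm u x = word_perm v x"
    using assms outside by (cases "x \<in> {1..n}") simp_all
qed

lemma twin_gen_closed: "i \<in> {1..n - 1} \<Longrightarrow> twin_gen n i \<in> carrier (twin_group n)"
  unfolding twin_gen_def twin_group_def by (rule presented_gen_closed)

lemma twin_elt_closed: "set w \<subseteq> {1..n - 1} \<Longrightarrow> twin_elt n w \<in> carrier (twin_group n)"
proof (induction w)
  case (Cons i w)
  then show ?case
    using group.is_monoid[OF group_twin_group] by (auto intro!: monoid.m_closed twin_gen_closed)
qed (use group.is_monoid[OF group_twin_group] in auto)

lemma twin_gen_involution: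
  assumes "i \<in> {1..n - 1}"
  shows "twin_gen n i \<otimes>\<^bsub>twin_group n\<^esub> twin_gen n i = \<one>\<^bsub>twin_group n\<^esub>"
proof -
  have "gword_cong {1..n - 1} (twin_relations n) [(i, True), (i, True)] []"
    using assms by (intro gword_cong.relation) (auto simp: twin_relations_def)
  then show ?thesis
    using assms
    by (simp add: twin_gen_def twin_group_def presented_gen_def presented_mult presented_one)
      (intro equiv_class_eq[OF equiv_gword_rel], simp add: gword_rel_def)
qed

lemma twin_gen_commute:
  assumes "i \<in> {1..n - 1}" "j \<in> {1..n - 1}" "\<bar>int i - int j\<bar> \<ge> 2"
  shows "twin_gen n i \<otimes>\<^bsub>twin_group n\<^esub> twin_gen n j = twin_gen n j \<otimes>\<^bsub>twin_group n\<^esub> twin_gen n i"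
proof -
  have "gword_cong {1..n - 1} (twin_relations n) [(i, True), (j, True)] [(j, True), (i, True)]"
    using assms by (intro gword_cong.relation) (auto simp: twin_relations_def)
  then show ?thesis
    using assms
    by (simp add: twin_gen_def twin_group_def presented_gen_def presented_mult)
      (intro equiv_class_eq[OF equiv_gword_rel], simp add: gword_rel_def)
qed

lemma twin_gen_cancel:
  assumes "i \<in> {1..n - 1}" "x \<in> carrier (twin_group n)"
  shows "twin_gen n i \<otimes>\<^bsub>twin_group n\<^esub> (twin_gen n i \<otimes>\<^bsub>twin_group n\<^esub> x) = x"
proof -
  interpret group "twin_group n" by (rule group_twin_group)
  show ?thesis
    using assms twin_gen_closed[OF assms(1)]
    by (simp add: m_assoc[symmetric] twin_gen_involution)
qed

lemma twin_gen_commute_left: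
  assumes "i \<in> {1..n - 1}" "j \<in> {1..n - 1}" "\<bar>int i - int j\<bar> \<ge> 2" "x \<in> carrier (twin_group n)"
  shows "twin_gen n i \<otimes>\<^bsub>twin_group n\<^esub> (twin_gen n j \<otimes>\<^bsub>twin_group n\<^esub> x)
    = twin_gen n j \<otimes>\<^bsub>twin_group n\<^esub> (twin_gen n i \<otimes>\<^bsub>twin_group n\<^esub> x)"
proof -
  interpret group "twin_group n" by (rule group_twin_group)
  show ?thesis
    using assms twin_gen_closed[OF assms(1)] twin_gen_closed[OF assms(2)]
    by (simp add: m_assoc[symmetric] twin_gen_commute)
qed

lemma twin_perm_twin_elt:
  assumes "set w \<subseteq> {1..n - 1}"
  shows "twin_perm n (twin_elt n w) = word_perm w"
proof -
  interpret group_hom "twin_group n" "sym_group n" "twin_perm n"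
    by (intro group_hom.intro group_hom_axioms.intro group_twin_group sym_group_is_group
        twin_perm_hom)
  show ?thesis
    using assms
  proof (induction w)
    case Nil
    then show ?case using hom_one by (simp add: sym_group_one)
  next
    case (Cons i w)
    then show ?case
      using twin_gen_closed[of i n] twin_elt_closed[of w n] twin_perm_gen[of i n]
      by (simp add: sym_group_mult)
  qed
qed

text \<open>Words are closed under concatenation, and the inverse of a generator is the one-letter
  word itself.\<close>

lemma twin_group_elts:
  assumes "g \<in> carrier (twin_group n)"
  obtains w where "set w \<subseteq> {1..n - 1}" "g = twin_elt n w"
proof -
  interpret group "twin_group n" by (rule group_twin_group)
  let ?H = "twin_gen n ` {1..n - 1}"
  have app: "twin_elt n (u @ v) = twin_elt n u \<otimes>\<^bsub>twin_group n\<^esub> twin_elt n v"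
    if "set u \<subseteq> {1..n - 1}" "set v \<subseteq> {1..n - 1}" for u v
    using that
  proof (induction u)
    case (Cons i u)
    then show ?case using twin_gen_closed[of i n] twin_elt_closed[of _ n] by (simp add: m_assoc)
  qed (simp add: twin_elt_closed)
  have "g \<in> generate (twin_group n) ?H"
    using assms presented_group_generate[of "{1..n - 1}" "twin_relations n"]
    by (simp add: twin_group_def twin_gen_def[abs_def])
  then have "\<exists>w. set w \<subseteq> {1..n - 1} \<and> g = twin_elt n w"
  proof induction
    case one
    then show ?case by (intro exI[of _ "[]"]) simp
  next
    case (incl h)
    then obtain i where "i \<in> {1..n - 1}" "h = twin_gen n i" by auto
    then show ?case using twin_gen_closed[of i n] by (intro exI[of _ "[i]"]) simp
  next
    case (inv h)
    then obtain i where i: "i \<in> {1..n - 1}" "h = twin_gen n i" by auto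
    then have "inv\<^bsub>twin_group n\<^esub> h = h"
      using twin_gen_involution[of i n] twin_gen_closed[of i n] by (intro inv_equality) auto
    then show ?case using i twin_gen_closed[of i n] by (intro exI[of _ "[i]"]) simp
  next
    case (eng g h)
    then obtain u v where "set u \<subseteq> {1..n - 1}" "g = twin_elt n u"
      "set v \<subseteq> {1..n - 1}" "h = twin_elt n v" by blast
    then show ?case using app[of u v] by (intro exI[of _ "u @ v"]) auto
  qed
  then show ?thesis using that by blast
qed

section \<open>Axioms for a labelled covering\<close>

text \<open>The involution and commutation axioms make the labelled moves respect the defining
  relations of T_n. By \<open>rep_path\<close>, the word \<open>rep q\<close> leads from
  \<open>base\<close> to \<open>q\<close> with trivial total label. By \<open>rep_step\<close>,
  \<open>\<psi>\<close> records in T_n how far a letter deviates from the chosen representatives.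
  The two permutation axioms relate \<open>\<psi>\<close> to the kernel: \<open>perm_step\<close>
  makes its image pure, and \<open>perm_inj\<close> makes it all of the pure group.\<close>

locale twin_covering = F: group F
  for F :: "('f, 'm) monoid_scheme" and n :: nat +
  fixes move :: "nat \<Rightarrow> 'q \<Rightarrow> 'q" and label :: "nat \<Rightarrow> 'q \<Rightarrow> 'f"
    and base :: 'q and rep :: "'q \<Rightarrow> nat list" and \<psi> :: "'f \<Rightarrow> nat gword set"
  assumes label_closed: "i \<in> {1..n - 1} \<Longrightarrow> label i q \<in> carrier F"
    and move_involution: "i \<in> {1..n - 1} \<Longrightarrow> move i (move i q) = q"
    and label_involution: "i \<in> {1..n - 1} \<Longrightarrow> label i (move i q) \<otimes>\<^bsub>F\<^esub> label i q = \<one>\<^bsub>F\<^esub>"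
    and move_commute: "\<lbrakk>i \<in> {1..n - 1}; j \<in> {1..n - 1}; \<bar>int i - int j\<bar> \<ge> 2\<rbrakk>
      \<Longrightarrow> move i (move j q) = move j (move i q)"
    and label_commute: "\<lbrakk>i \<in> {1..n - 1}; j \<in> {1..n - 1}; \<bar>int i - int j\<bar> \<ge> 2\<rbrakk>
      \<Longrightarrow> label i (move j q) \<otimes>\<^bsub>F\<^esub> label j q = label j (move i q) \<otimes>\<^bsub>F\<^esub> label i q"
    and labels_generate: "carrier F \<subseteq> generate F {label i q | i q. i \<in> {1..n - 1}}"
    and psi_hom: "\<psi> \<in> hom F (twin_group n)"
    and rep_letters: "set (rep q) \<subseteq> {1..n - 1}"
    and rep_base: "rep base = []"
    and rep_path: "f \<in> carrier F \<Longrightarrow>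
      foldr (\<lambda>i (p, g). (move i p, label i p \<otimes>\<^bsub>F\<^esub> g)) (rep q) (base, f) = (q, f)"
    and rep_step: "i \<in> {1..n - 1} \<Longrightarrow> twin_elt n (i # rep q)
      = twin_elt n (rep (move i q)) \<otimes>\<^bsub>twin_group n\<^esub> \<psi> (label i q)"
    and perm_step: "i \<in> {1..n - 1} \<Longrightarrow> word_perm (i # rep q) = word_perm (rep (move i q))"
    and perm_inj: "word_perm (rep q) = id \<Longrightarrow> q = base"
begin

abbreviation T where "T \<equiv> twin_group n"

sublocale T: group T by (rule group_twin_group)

sublocale psi: group_hom F T \<psi>
  by unfold_locales (rule psi_hom)

sublocale perm: group_hom T "sym_group n" "twin_perm n"
  by (intro group_hom.intro group_hom_axioms.intro group_twin_group sym_group_is_group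
      twin_perm_hom)

section \<open>The action of T_n on states times F\<close>

definition step :: "nat \<Rightarrow> 'q \<times> 'f \<Rightarrow> 'q \<times> 'f" where
  "step i = (\<lambda>(p, g). (move i p, label i p \<otimes>\<^bsub>F\<^esub> g))"

abbreviation points :: "('q \<times> 'f) set" where "points \<equiv> UNIV \<times> carrier F"

text \<open>\<open>BijGroup\<close> consists of extensional bijections, hence the restriction to
  \<open>points\<close>.\<close>

definition act :: "nat gword set \<Rightarrow> 'q \<times> 'f \<Rightarrow> 'q \<times> 'f" where
  "act = presented_hom (BijGroup points) (\<lambda>i. restrict (step i) points)"

lemma step_closed: "i \<in> {1..n - 1} \<Longrightarrow> x \<in> points \<Longrightarrow> step i x \<in> points"
  by (auto simp: step_def label_closed)

lemma step_involution: "i \<in> {1..n - 1} \<Longrightarrow> x \<in> points \<Longrightarrow> step i (step i x) = x"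
  using label_closed
  by (auto simp: step_def move_involution label_involution F.m_assoc[symmetric])

lemma step_commute:
  "\<lbrakk>i \<in> {1..n - 1}; j \<in> {1..n - 1}; \<bar>int i - int j\<bar> \<ge> 2; x \<in> points\<rbrakk>
    \<Longrightarrow> step i (step j x) = step j (step i x)"
  using label_closed
  by (auto simp: step_def move_commute label_commute F.m_assoc[symmetric])

lemma step_Bij: "i \<in> {1..n - 1} \<Longrightarrow> restrict (step i) points \<in> Bij points"
  unfolding Bij_def
  by (auto intro!: bij_betwI[where g = "step i"] simp: step_closed step_involution)

lemma BijGroup_mult_apply:
  "\<lbrakk>f \<in> Bij S; g \<in> Bij S; x \<in> S\<rbrakk> \<Longrightarrow> (f \<otimes>\<^bsub>BijGroup S\<^esub> g) x = f (g x)"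
  by (simp add: BijGroup_def compose_def)

lemma step_relations:
  assumes "(u, v) \<in> twin_relations n"
  shows "gword_eval (BijGroup points) (\<lambda>i. restrict (step i) points) u
    = gword_eval (BijGroup points) (\<lambda>i. restrict (step i) points) v"
proof -
  interpret B: group "BijGroup points" by (rule group_BijGroup)
  have carr: "carrier (BijGroup points) = Bij points" by (simp add: BijGroup_def)
  let ?s = "\<lambda>i. restrict (step i) points"
  have comp: "?s i \<otimes>\<^bsub>BijGroup points\<^esub> ?s j = (\<lambda>x\<in>points. step i (step j x))"
    if "i \<in> {1..n - 1}" "j \<in> {1..n - 1}" for i j
    using step_Bij[OF that(1)] step_Bij[OF that(2)] step_closed[OF that(2)]
    by (auto simp: BijGroup_def compose_def fun_eq_iff)
  have inv: "?s i \<otimes>\<^bsub>BijGroup points\<^esub> ?s i = \<one>\<^bsub>BijGroup points\<^esub>" if "i \<in> {1..n - 1}" for i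
    unfolding comp[OF that that] using step_involution[OF that]
    by (auto simp: BijGroup_def fun_eq_iff)
  have com: "?s i \<otimes>\<^bsub>BijGroup points\<^esub> ?s j = ?s j \<otimes>\<^bsub>BijGroup points\<^esub> ?s i"
    if "i \<in> {1..n - 1}" "j \<in> {1..n - 1}" "\<bar>int i - int j\<bar> \<ge> 2" for i j
    unfolding comp[OF that(1,2)] comp[OF that(2,1)] using step_commute[OF that]
    by (auto simp: fun_eq_iff)
  have closed: "?s i \<in> carrier (BijGroup points)" if "i \<in> {1..n - 1}" for i
    using step_Bij[OF that] carr by simp
  from assms consider i where "i \<in> {1..n - 1}" "u = [(i, True), (i, True)]" "v = []"
    | i j where "i \<in> {1..n - 1}" "j \<in> {1..n - 1}" "\<bar>int i - int j\<bar> \<ge> 2"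
        "u = [(i, True), (j, True)]" "v = [(j, True), (i, True)]"
    unfolding twin_relations_def by blast
  then show ?thesis
  proof cases
    case 1
    then show ?thesis using inv[of i] closed[of i] by simp
  next
    case 2
    then show ?thesis using com[of i j] closed[of i] closed[of j] by simp
  qed
qed

lemma act_hom: "act \<in> hom T (BijGroup points)"
  unfolding act_def twin_group_def
proof (rule group.presented_hom[OF group_BijGroup])
  show "(\<lambda>i. restrict (step i) points) ` {1..n - 1} \<subseteq> carrier (BijGroup points)"
    using step_Bij by (auto simp: BijGroup_def)
qed (rule step_relations)

lemma act_gen: "i \<in> {1..n - 1} \<Longrightarrow> act (twin_gen n i) = restrict (step i) points"
  unfolding act_def twin_gen_def
proof (rule group.presented_hom_gen[OF group_BijGroup])
  show "(\<lambda>i. restrict (step i) points) ` {1..n - 1} \<subseteq> carrier (BijGroup points)"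
    using step_Bij by (auto simp: BijGroup_def)
qed (use step_relations in auto)

lemma act_Bij: "g \<in> carrier T \<Longrightarrow> act g \<in> Bij points"
  using act_hom by (auto simp: hom_def BijGroup_def)

lemma act_closed: "g \<in> carrier T \<Longrightarrow> x \<in> points \<Longrightarrow> act g x \<in> points"
  using Bij_imp_funcset[OF act_Bij] by (rule funcset_mem)

lemma act_mult:
  "\<lbrakk>g \<in> carrier T; h \<in> carrier T; x \<in> points\<rbrakk> \<Longrightarrow> act (g \<otimes>\<^bsub>T\<^esub> h) x = act g (act h x)"
  using act_hom act_Bij by (simp add: hom_mult BijGroup_mult_apply)

lemma act_one: "x \<in> points \<Longrightarrow> act \<one>\<^bsub>T\<^esub> x = x"
  using hom_one[OF act_hom group_twin_group group_BijGroup]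
  by (simp add: BijGroup_def)

lemma act_inj: "\<lbrakk>g \<in> carrier T; x \<in> points; y \<in> points; act g x = act g y\<rbrakk> \<Longrightarrow> x = y"
  using act_Bij by (auto simp: Bij_def bij_betw_def inj_on_def)

lemma act_twin_elt:
  assumes "set w \<subseteq> {1..n - 1}" "x \<in> points"
  shows "act (twin_elt n w) x = foldr step w x \<and> foldr step w x \<in> points"
  using assms(1)
proof (induction w)
  case Nil
  then show ?case using assms(2) act_one by simp
next
  case (Cons i w)
  then have i: "i \<in> {1..n - 1}" and w: "set w \<subseteq> {1..n - 1}" by auto
  with Cons.IH assms(2) show ?case
    using step_closed[OF i] act_mult[OF twin_gen_closed[OF i] twin_elt_closed[OF w] assms(2)] act_gen[OF i]
    by (simp)
qed

lemma act_rep: "f \<in> carrier F \<Longrightarrow> act (twin_elt n (rep q)) (base, f) = (q, f)"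
  using act_twin_elt[OF rep_letters, of "(base, f)" q] rep_path[of f q]
  by (simp add: step_def[abs_def])

text \<open>Both sides become equal after acting by the representative of \<open>move i q\<close>.
  On the left, \<open>rep_step\<close> turns the product into the letter i after
  \<open>rep q\<close>, which runs from the base to \<open>q\<close> and then crosses the labelled
  edge.\<close>

lemma act_psi_label:
  assumes i: "i \<in> {1..n - 1}" and f: "f \<in> carrier F"
  shows "act (\<psi> (label i q)) (base, f) = (base, label i q \<otimes>\<^bsub>F\<^esub> f)"
proof (rule act_inj)
  let ?t = "twin_elt n (rep (move i q))"
  show t: "?t \<in> carrier T" using rep_letters by (rule twin_elt_closed)
  have c: "label i q \<in> carrier F" using i by (rule label_closed)
  then show "act (\<psi> (label i q)) (base, f) \<in> points" "(base, label i q \<otimes>\<^bsub>F\<^esub> f) \<in> points"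
    using act_closed[OF psi.hom_closed[OF c], of "(base, f)"] f by auto
  have "act ?t (act (\<psi> (label i q)) (base, f)) = act (?t \<otimes>\<^bsub>T\<^esub> \<psi> (label i q)) (base, f)"
    using t c f by (simp add: act_mult)
  also have "\<dots> = act (twin_gen n i \<otimes>\<^bsub>T\<^esub> twin_elt n (rep q)) (base, f)"
    using rep_step[OF i, of q] by simp
  also have "\<dots> = step i (q, f)"
    using act_mult[OF twin_gen_closed[OF i] twin_elt_closed[OF rep_letters]] f
    by (simp add: act_rep act_gen[OF i])
  also have "\<dots> = act ?t (base, label i q \<otimes>\<^bsub>F\<^esub> f)"
    using c f by (simp add: step_def act_rep)
  finally show "act ?t (act (\<psi> (label i q)) (base, f)) = act ?t (base, label i q \<otimes>\<^bsub>F\<^esub> f)" .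
qed

lemma labels_closed: "{label i q | i q. i \<in> {1..n - 1}} \<subseteq> carrier F"
  using label_closed by auto

lemma act_psi:
  assumes "h \<in> carrier F" "f \<in> carrier F"
  shows "act (\<psi> h) (base, f) = (base, h \<otimes>\<^bsub>F\<^esub> f)"
proof -
  have "h \<in> generate F {label i q | i q. i \<in> {1..n - 1}}" using assms labels_generate by auto
  then show ?thesis
    using assms(2)
  \<comment> \<open>The second coordinate stays general because a product g h uses the hypothesis
    for g at the point with coordinate h f.\<close>
  proof (induction arbitrary: f)
    case one
    then show ?case by (simp add: act_one)
  next
    case (incl h)
    then show ?case using act_psi_label by auto
  next
    case (inv h)
    then have h: "h \<in> carrier F" using labels_closed by auto
    \<comment> \<open>\<open>\<psi> h\<close> acts injectively, so the formula for the inverse may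
      be tested after applying it.\<close>
    show ?case
    proof (rule act_inj[OF psi.hom_closed[OF h]])
      show "act (\<psi> (inv\<^bsub>F\<^esub> h)) (base, f) \<in> points"
        using h inv by (intro act_closed) auto
      show "(base, inv\<^bsub>F\<^esub> h \<otimes>\<^bsub>F\<^esub> f) \<in> points" using h inv by auto
      have "act (\<psi> h) (act (\<psi> (inv\<^bsub>F\<^esub> h)) (base, f)) = (base, f)"
        using h inv act_mult[of "\<psi> h" "\<psi> (inv\<^bsub>F\<^esub> h)" "(base, f)"] by (simp add: act_one)
      moreover have "act (\<psi> h) (base, inv\<^bsub>F\<^esub> h \<otimes>\<^bsub>F\<^esub> f) = (base, h \<otimes>\<^bsub>F\<^esub> (inv\<^bsub>F\<^esub> h \<otimes>\<^bsub>F\<^esub> f))"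
        using inv h act_psi_label by auto
      ultimately show "act (\<psi> h) (act (\<psi> (inv\<^bsub>F\<^esub> h)) (base, f))
          = act (\<psi> h) (base, inv\<^bsub>F\<^esub> h \<otimes>\<^bsub>F\<^esub> f)"
        using h inv by (simp add: F.m_assoc[symmetric])
    qed
  next
    case (eng g h)
    have "g \<in> carrier F" "h \<in> carrier F"
      using eng F.generate_in_carrier[OF labels_closed] by auto
    then show ?case using eng act_mult[of "\<psi> g" "\<psi> h" "(base, f)"] by (simp add: F.m_assoc)
  qed
qed

section \<open>The image and injectivity of psi\<close>

text \<open>An element of F is recovered from the action of its image on the base point with trivial
  second coordinate.\<close>

lemma psi_inj: "inj_on \<psi> (carrier F)"
proof (rule inj_onI)
  fix g h assume g: "g \<in> carrier F" and h: "h \<in> carrier F" and eq: "\<psi> g = \<psi> h"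
  have "(base, g) = act (\<psi> g) (base, \<one>\<^bsub>F\<^esub>)" using g by (simp add: act_psi)
  also have "\<dots> = (base, h)" unfolding eq using h by (simp add: act_psi)
  finally show "g = h" by simp
qed

text \<open>By \<open>rep_step\<close>, the image of a label is the quotient of two words, and these
  have equal permutations by \<open>perm_step\<close>. Since labels generate F, the composite with
  \<open>twin_perm\<close> agrees everywhere with the trivial homomorphism.\<close>

lemma perm_psi:
  assumes "h \<in> carrier F"
  shows "twin_perm n (\<psi> h) = id"
proof -
  have "twin_perm n (\<psi> (label i q)) = \<one>\<^bsub>sym_group n\<^esub>" if i: "i \<in> {1..n - 1}" for i q
  proof -
    let ?t = "twin_elt n (rep (move i q))"
    have t: "?t \<in> carrier T" using rep_letters by (rule twin_elt_closed)
    have c: "\<psi> (label i q) \<in> carrier T" using label_closed[OF i] by simp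
    have "twin_perm n ?t \<otimes>\<^bsub>sym_group n\<^esub> twin_perm n (\<psi> (label i q)) = twin_perm n (twin_elt n (i # rep q))"
      using t c rep_step[OF i, of q] by simp
    also have "\<dots> = twin_perm n ?t"
      using i rep_letters perm_step[OF i, of q] by (subst (1 2) twin_perm_twin_elt) auto
    finally show ?thesis using t c by simp
  qed
  then have labels: "(twin_perm n \<circ> \<psi>) x = (\<lambda>_. \<one>\<^bsub>sym_group n\<^esub>) x"
    if "x \<in> {label i q | i q. i \<in> {1..n - 1}}" for x
    using that by auto
  have "(\<lambda>_. \<one>\<^bsub>sym_group n\<^esub>) \<in> hom F (sym_group n)"
    by (rule homI) simp_all
  from F.hom_agree_on_generate[OF sym_group_is_group hom_compose[OF psi_hom twin_perm_hom] this
      labels_closed labels]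
  have "(twin_perm n \<circ> \<psi>) h = (\<lambda>_. \<one>\<^bsub>sym_group n\<^esub>) h"
    using assms labels_generate by blast
  then show ?thesis by (simp add: sym_group_one)
qed

text \<open>Prepending a letter moves the state along its edge, and the label of that edge is
  absorbed on the left of h.\<close>

lemma rep_cover:
  assumes "set w \<subseteq> {1..n - 1}"
  shows "\<exists>q. \<exists>h\<in>carrier F. twin_elt n w = twin_elt n (rep q) \<otimes>\<^bsub>T\<^esub> \<psi> h"
  using assms
proof (induction w)
  case Nil
  then show ?case by (intro exI[of _ base] bexI[of _ "\<one>\<^bsub>F\<^esub>"]) (simp_all add: rep_base)
next
  case (Cons i w)
  then obtain q h where i: "i \<in> {1..n - 1}" and h: "h \<in> carrier F"
    and w: "twin_elt n w = twin_elt n (rep q) \<otimes>\<^bsub>T\<^esub> \<psi> h" by auto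
  have c: "label i q \<in> carrier F" using i by (rule label_closed)
  have "twin_elt n (i # w) = twin_elt n (i # rep q) \<otimes>\<^bsub>T\<^esub> \<psi> h"
    using w h twin_gen_closed[OF i] twin_elt_closed[OF rep_letters] by (simp add: T.m_assoc)
  also have "\<dots> = twin_elt n (rep (move i q)) \<otimes>\<^bsub>T\<^esub> \<psi> (label i q \<otimes>\<^bsub>F\<^esub> h)"
    using c h rep_step[OF i] twin_elt_closed[OF rep_letters] by (simp add: T.m_assoc del: twin_elt_simps)
  finally show ?case using c h by blast
qed

text \<open>In the factorization from \<open>rep_cover\<close> the factor from F is pure, so a pure
  element forces \<open>rep q\<close> to have trivial permutation; then \<open>q\<close> is the base
  and its word is empty.\<close>

lemma psi_surj:
  assumes "g \<in> kernel T (sym_group n) (twin_perm n)"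
  shows "g \<in> \<psi> ` carrier F"
proof -
  from assms have g: "g \<in> carrier T" "twin_perm n g = id"
    by (auto simp: kernel_def sym_group_one)
  then obtain q h where h: "h \<in> carrier F" and q: "g = twin_elt n (rep q) \<otimes>\<^bsub>T\<^esub> \<psi> h"
    using twin_group_elts[of g n] rep_cover by metis
  have "word_perm (rep q) = id"
    using g(2) h twin_elt_closed[OF rep_letters, of q] perm_psi[OF h]
    by (simp add: q twin_perm_twin_elt[OF rep_letters] sym_group_mult)
  then have "q = base" by (rule perm_inj)
  then show ?thesis using h q by (simp add: rep_base)
qed

theorem pure_twin_group_iso: "pure_twin_group n \<cong> F"
proof -
  have "\<psi> ` carrier F \<subseteq> kernel T (sym_group n) (twin_perm n)"
    by (auto simp: kernel_def sym_group_one perm_psi)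
  with psi_surj have "\<psi> ` carrier F = kernel T (sym_group n) (twin_perm n)"
    by blast
  moreover from this have "\<psi> \<in> hom F (pure_twin_group n)"
    unfolding pure_twin_group_def by (intro homI) (simp_all, blast)
  ultimately have "\<psi> \<in> iso F (pure_twin_group n)"
    using psi_inj unfolding iso_iff pure_twin_group_def by simp
  then show ?thesis by (rule F.iso_sym[OF is_isoI])
qed

end

section \<open>Four and three strands\<close>

text \<open>With x and y the representatives of the target and source of an s-edge,
  \<open>inv x \<otimes> (s \<otimes> y)\<close> is the loop through that edge. The two identities
  are the instances of \<open>rep_step\<close> for crossing it forwards, with the loop, and
  backwards, with its inverse.\<close>

lemma (in group) involution_edge:
  assumes "s \<in> carrier G" "s \<otimes> s = \<one>" "x \<in> carrier G" "y \<in> carrier G"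
  shows "x \<otimes> (inv x \<otimes> (s \<otimes> y)) = s \<otimes> y"
    and "y \<otimes> inv (inv x \<otimes> (s \<otimes> y)) = s \<otimes> x"
proof -
  have s: "inv s = s" using assms by (intro inv_equality) auto
  show "x \<otimes> (inv x \<otimes> (s \<otimes> y)) = s \<otimes> y"
    using assms by (simp add: m_assoc[symmetric])
  have "y \<otimes> inv (inv x \<otimes> (s \<otimes> y)) = y \<otimes> (inv y \<otimes> (s \<otimes> x))"
    using assms by (simp add: inv_mult_group s m_assoc)
  also have "\<dots> = s \<otimes> x" using assms by (simp add: m_assoc[symmetric])
  finally show "y \<otimes> inv (inv x \<otimes> (s \<otimes> y)) = s \<otimes> x" .
qed

section \<open>Four strands: the octahedron\<close>

text \<open>The coset of \<open>p\<close> modulo \<open>\<langle>s\<^sub>1, s\<^sub>3\<rangle>\<close> is named after the preimage of \<open>{1, 2}\<close> under \<open>p\<close>; a state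
  \<open>(a, b, v)\<close> stands for \<open>s\<^sub>1\<^sup>a s\<^sub>3\<^sup>b\<close> times the chosen representative of \<open>v\<close>. The tables list the action of
  \<open>s\<^sub>2\<close>; the edges with empty label form a spanning tree of the octahedron.\<close>

datatype vertex4 = V12 | V13 | V14 | V23 | V24 | V34

type_synonym state4 = "bool \<times> bool \<times> vertex4"

text \<open>The 24 states enumerate S_4 through \<open>word_perm (word4 q)\<close>, and each row is
  left multiplication by the transposition of 2 and 3. The rows pair up into the 12 edges of the
  octahedron.\<close>

fun swap4 :: "state4 \<Rightarrow> state4" where
  "swap4 (False, False, V12) = (False, False, V13)" |
  "swap4 (False, False, V13) = (False, False, V12)" |
  "swap4 (False, False, V23) = (True, False, V12)" |
  "swap4 (False, False, V14) = (False, True, V12)" |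
  "swap4 (False, False, V24) = (True, True, V12)" |
  "swap4 (False, False, V34) = (True, True, V13)" |
  "swap4 (False, True, V12) = (False, False, V14)" |
  "swap4 (False, True, V13) = (False, True, V14)" |
  "swap4 (False, True, V23) = (False, True, V24)" |
  "swap4 (False, True, V14) = (False, True, V13)" |
  "swap4 (False, True, V24) = (False, True, V23)" |
  "swap4 (False, True, V34) = (True, True, V23)" |
  "swap4 (True, False, V12) = (False, False, V23)" |
  "swap4 (True, False, V13) = (True, False, V23)" |
  "swap4 (True, False, V23) = (True, False, V13)" |
  "swap4 (True, False, V14) = (True, False, V24)" |
  "swap4 (True, False, V24) = (True, False, V14)" |
  "swap4 (True, False, V34) = (True, True, V14)" |
  "swap4 (True, True, V12) = (False, False, V24)" |
  "swap4 (True, True, V13) = (False, False, V34)" |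
  "swap4 (True, True, V23) = (False, True, V34)" |
  "swap4 (True, True, V14) = (True, False, V34)" |
  "swap4 (True, True, V24) = (True, True, V34)" |
  "swap4 (True, True, V34) = (True, True, V24)"

text \<open>The fourteen nonempty rows are the seven edges outside the tree, one per free generator,
  with opposite letters in the two directions.\<close>

fun edge4 :: "state4 \<Rightarrow> nat gword" where
  "edge4 (False, True, V13) = [(2, True)]" |
  "edge4 (False, True, V23) = [(3, True)]" |
  "edge4 (False, True, V14) = [(2, False)]" |
  "edge4 (False, True, V24) = [(3, False)]" |
  "edge4 (False, True, V34) = [(4, False)]" |
  "edge4 (True, False, V13) = [(1, True)]" |
  "edge4 (True, False, V23) = [(1, False)]" |
  "edge4 (True, False, V14) = [(5, True)]" |
  "edge4 (True, False, V24) = [(5, False)]" |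
  "edge4 (True, False, V34) = [(6, False)]" |
  "edge4 (True, True, V23) = [(4, True)]" |
  "edge4 (True, True, V14) = [(6, True)]" |
  "edge4 (True, True, V24) = [(7, True)]" |
  "edge4 (True, True, V34) = [(7, False)]" |
  "edge4 _ = []"

text \<open>The state at which edge k is crossed with its positive letter; generators count from 1
  and list positions from 0.\<close>

definition source4 :: "nat \<Rightarrow> state4" where
  "source4 k = [(True, False, V13),
    (False, True, V13),
    (False, True, V23),
    (True, True, V23),
    (True, False, V14),
    (True, True, V14),
    (True, True, V24)] ! (k - 1)"

text \<open>Paths in the spanning tree, read from right to left: \<open>V13\<close>,
  \<open>V23\<close>, \<open>V14\<close> and \<open>V24\<close> hang from \<open>V12\<close>, and
  \<open>V34\<close> hangs from \<open>V13\<close>.\<close>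

fun vertex_word4 :: "vertex4 \<Rightarrow> nat list" where
  "vertex_word4 V12 = []" |
  "vertex_word4 V13 = [2]" |
  "vertex_word4 V23 = [2, 1]" |
  "vertex_word4 V14 = [2, 3]" |
  "vertex_word4 V24 = [2, 1, 3]" |
  "vertex_word4 V34 = [2, 1, 3, 2]"

fun word4 :: "state4 \<Rightarrow> nat list" where
  "word4 (a, b, v) = (if a then [1] else []) @ (if b then [3] else []) @ vertex_word4 v"

fun move4 :: "nat \<Rightarrow> state4 \<Rightarrow> state4" where
  "move4 i (a, b, v) = (if i = 1 then (\<not> a, b, v) else if i = 3 then (a, \<not> b, v) else swap4 (a, b, v))"

definition label4 :: "nat \<Rightarrow> state4 \<Rightarrow> nat gword set" where
  "label4 i q = gword_rel {1..7} {} `` {if i = 2 then edge4 q else []}"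

text \<open>The fundamental loop of edge k: out along the tree to its source, across the edge, and
  back along the tree from its target.\<close>

definition loop4 :: "nat \<Rightarrow> nat gword set" where
  "loop4 k = inv\<^bsub>twin_group 4\<^esub> twin_elt 4 (word4 (swap4 (source4 k))) \<otimes>\<^bsub>twin_group 4\<^esub>
    twin_elt 4 (2 # word4 (source4 k))"

lemma word4_letters: "set (word4 q) \<subseteq> {1..4 - 1}"
  by (cases q rule: swap4.cases) auto

lemma loop4_closed: "loop4 k \<in> carrier (twin_group 4)"
proof -
  interpret T: group "twin_group 4" by (rule group_twin_group)
  show ?thesis unfolding loop4_def
    by (intro T.m_closed T.inv_closed twin_elt_closed) (use word4_letters in auto)
qed

lemma generator_cases4: "i \<in> {1..4 - 1::nat} \<Longrightarrow> i = 1 \<or> i = 2 \<or> i = 3"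
  by auto

text \<open>Replaces the 24-row table by three uniform cases: a tree edge, edge k forwards, edge k
  backwards.\<close>

lemma edge4_cases:
  obtains "edge4 q = []"
  | k where "k \<in> {1..7}" "edge4 q = [(k, True)]" "source4 k = q"
  | k where "k \<in> {1..7}" "edge4 q = [(k, False)]" "source4 k = swap4 q"
  by (cases q rule: swap4.cases) (simp_all add: source4_def)

lemma edge4_gwords: "edge4 q \<in> gwords {1..7}"
  by (cases q rule: edge4_cases) auto

lemma edge4_source4: "k \<in> {1..7} \<Longrightarrow> edge4 (source4 k) = [(k, True)]"
proof -
  assume "k \<in> {1..7}"
  then have "k = 1 \<or> k = 2 \<or> k = 3 \<or> k = 4 \<or> k = 5 \<or> k = 6 \<or> k = 7" by auto
  then show ?thesis by (elim disjE) (simp_all add: source4_def)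
qed

lemma swap4_swap4: "swap4 (swap4 q) = q"
  by (cases q rule: swap4.cases) auto

lemma move4_2: "move4 2 q = swap4 q"
  by (cases q) auto

lemma edge4_swap4: "edge4 (swap4 q) = map (\<lambda>(k, b). (k, \<not> b)) (edge4 q)"
  by (cases q rule: swap4.cases) auto

lemma label4_closed: "label4 i q \<in> carrier (free_group {1..7})"
  unfolding label4_def free_group_def
  by (intro presented_carrierI) (use edge4_gwords in auto)

lemma label4_swap4: "label4 2 (swap4 q) \<otimes>\<^bsub>free_group {1..7}\<^esub> label4 2 q = \<one>\<^bsub>free_group {1..7}\<^esub>"
proof -
  have "gword_cong {1..7} {} (edge4 (swap4 q) @ edge4 q) []"
    using gword_cong.cancel[of _ "{1..7::nat}" "{}" True] gword_cong.cancel[of _ "{1..7::nat}" "{}" False]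
    by (cases q rule: edge4_cases) (auto simp: edge4_swap4 intro: gword_cong.refl)
  then have "gword_rel {1..7} {} `` {edge4 (swap4 q) @ edge4 q} = gword_rel {1..7} {} `` {[]}"
    by (intro equiv_class_eq[OF equiv_gword_rel]) (simp add: gword_rel_def)
  then show ?thesis
    using edge4_gwords[of q] edge4_gwords[of "swap4 q"]
    by (simp add: label4_def free_group_def presented_mult presented_one del: One_nat_def)
qed

abbreviation psi4 :: "nat gword set \<Rightarrow> nat gword set" where
  "psi4 \<equiv> presented_hom (twin_group 4) loop4"

lemma psi4_hom: "psi4 \<in> hom (free_group {1..7}) (twin_group 4)"
  unfolding free_group_def
  by (rule group.presented_hom[OF group_twin_group]) (use loop4_closed in auto)

lemma psi4_label4: "psi4 (label4 i q) = gword_eval (twin_group 4) loop4 (if i = 2 then edge4 q else [])"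
  unfolding label4_def
  by (rule group.presented_hom_class[OF group_twin_group])
    (use loop4_closed edge4_gwords in auto)

text \<open>The representatives were read along the tree, so on a tree edge either the two words
  coincide or a doubled s_2 cancels.\<close>

lemma tree4:
  assumes "edge4 q = []"
  shows "twin_elt 4 (2 # word4 q) = twin_elt 4 (word4 (swap4 q))"
proof -
  interpret T: group "twin_group 4" by (rule group_twin_group)
  show ?thesis
    using assms
    by (cases q rule: swap4.cases)
      (auto simp: twin_gen_closed[of _ 4] twin_gen_cancel[of _ 4] twin_gen_involution[of _ 4])
qed

lemma word4_move4:
  assumes "i = 1 \<or> i = 3"
  shows "twin_elt 4 (i # word4 q) = twin_elt 4 (word4 (move4 i q))"
proof -
  interpret T: group "twin_group 4" by (rule group_twin_group)
  obtain a b v where q: "q = (a, b, v)" by (cases q)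
  have v: "twin_elt 4 (vertex_word4 v) \<in> carrier (twin_group 4)"
    by (rule twin_elt_closed) (cases v; simp)
  then show ?thesis
    \<comment> \<open>The prefix is ordered as s_1 before s_3, so prepending s_3 when s_1 is present
      needs the commutation; the rest is cancellation.\<close>
    using assms twin_gen_commute_left[of 3 4 1]
    by (auto simp: q twin_gen_closed[of _ 4] twin_gen_cancel[of _ 4])
qed

lemma step4:
  assumes "i \<in> {1..4 - 1}"
  shows "twin_elt 4 (i # word4 q)
    = twin_elt 4 (word4 (move4 i q)) \<otimes>\<^bsub>twin_group 4\<^esub> psi4 (label4 i q)"
proof -
  interpret T: group "twin_group 4" by (rule group_twin_group)
  have closed: "twin_elt 4 (word4 p) \<in> carrier (twin_group 4)" for p
    using word4_letters by (rule twin_elt_closed)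
  have s: "twin_gen 4 2 \<in> carrier (twin_group 4)"
      "twin_gen 4 2 \<otimes>\<^bsub>twin_group 4\<^esub> twin_gen 4 2 = \<one>\<^bsub>twin_group 4\<^esub>"
    by (auto intro!: twin_gen_closed twin_gen_involution)
  show ?thesis
  proof (cases "i = 2")
    case False
    with assms have "i = 1 \<or> i = 3" using generator_cases4 by auto
    then show ?thesis using closed
      by (simp add: psi4_label4 word4_move4 False del: twin_elt_simps word4.simps)
  next
    case True
    show ?thesis
    proof (cases q rule: edge4_cases)
      case 1
      then show ?thesis using closed
        by (simp add: psi4_label4 True move4_2 tree4 del: twin_elt_simps)
    next
      \<comment> \<open>Here \<open>q\<close> is the source of edge k, so the label maps to
        \<open>loop4 k\<close>; in the next case \<open>q\<close> is the target and the inverse loop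
        appears.\<close>
      case (2 k)
      then show ?thesis
        using T.involution_edge(1)[OF s closed[of "swap4 q"] closed[of q]] loop4_closed[of k]
        by (simp add: psi4_label4 True move4_2 loop4_def)
    next
      case (3 k)
      then show ?thesis
        using T.involution_edge(2)[OF s closed[of q] closed[of "swap4 q"]] loop4_closed[of k]
        by (simp add: psi4_label4 True move4_2 loop4_def swap4_swap4)
    qed
  qed
qed

text \<open>A permutation of four points is determined by three values, so three evaluations
  separate the 24 words from the identity.\<close>

lemma word4_perm_inj:
  assumes "word_perm (word4 q) = id"
  shows "q = (False, False, V12)"
proof -
  have "word_perm (word4 q) 1 = 1" "word_perm (word4 q) 2 = 2" "word_perm (word4 q) 3 = 3"
    using assms by auto
  then show ?thesis
    by (cases q rule: swap4.cases) (simp_all add: transpose_def)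
qed

text \<open>Across an edge outside the tree the two words differ in T_4 by a loop, so equality is
  checked on permutations, point by point.\<close>

lemma source4_perm_step:
  assumes "k \<in> {1..7}"
  shows "word_perm (2 # word4 (source4 k)) = word_perm (word4 (swap4 (source4 k)))"
proof (rule word_perm_eqI)
  fix x :: nat assume "x \<in> {1..4}"
  then have "x = 1 \<or> x = 2 \<or> x = 3 \<or> x = 4" by auto
  moreover from assms have "k = 1 \<or> k = 2 \<or> k = 3 \<or> k = 4 \<or> k = 5 \<or> k = 6 \<or> k = 7" by auto
  ultimately show "word_perm (2 # word4 (source4 k)) x = word_perm (word4 (swap4 (source4 k))) x"
    by (elim disjE) (simp_all add: source4_def transpose_def)
qed (use word4_letters in \<open>auto simp del: word4.simps\<close>)

lemma word4_perm_step:
  assumes "i \<in> {1..4 - 1}"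
  shows "word_perm (i # word4 q) = word_perm (word4 (move4 i q))"
proof -
  have eq: "word_perm (i # word4 q) = word_perm (word4 p)"
    if "twin_elt 4 (i # word4 q) = twin_elt 4 (word4 p)" for p
  proof -
    have "set (i # word4 q) \<subseteq> {1..4 - 1}" using assms word4_letters[of q] by simp
    from twin_perm_twin_elt[OF this] twin_perm_twin_elt[OF word4_letters[of p]] that
    show ?thesis by metis
  qed
  show ?thesis
  proof (cases "i = 2")
    case False
    then show ?thesis using generator_cases4[OF assms] by (intro eq word4_move4) auto
  next
    case i: True
    show ?thesis unfolding i move4_2
    proof (cases q rule: edge4_cases)
      case 1
      then show "word_perm (2 # word4 q) = word_perm (word4 (swap4 q))"
        using eq[OF tree4[of q, folded i]] i by simp
    next
      case (2 k)
      then show "word_perm (2 # word4 q) = word_perm (word4 (swap4 q))"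
        using source4_perm_step[of k] by simp
    next
      case (3 k)
      then have "word_perm (2 # word4 (swap4 q)) = word_perm (word4 q)"
        using source4_perm_step[of k] by (simp add: swap4_swap4)
      \<comment> \<open>The backward crossing follows from the forward one by composing with the
        transposition, which then cancels against itself.\<close>
      then have "word_perm (2 # word4 q) = transpose 2 3 \<circ> (transpose 2 3 \<circ> word_perm (word4 (swap4 q)))"
        by simp
      then show "word_perm (2 # word4 q) = word_perm (word4 (swap4 q))"
        by (simp add: o_assoc)
    qed
  qed
qed

lemma pure_twin_group_4: "pure_twin_group 4 \<cong> free_group {1..7::nat}"
proof (rule twin_covering.pure_twin_group_iso)
  interpret F: group "free_group {1..7::nat}" by (rule group_free_group)
  have one: "label4 i q = \<one>\<^bsub>free_group {1..7}\<^esub>" if "i \<noteq> 2" for i q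
    using that by (simp add: label4_def free_group_def presented_one)
  show "twin_covering (free_group {1..7}) 4 move4 label4 (False, False, V12) word4 psi4"
  proof (intro twin_covering.intro twin_covering_axioms.intro)
    fix i q assume i: "i \<in> {1..4 - 1::nat}"
    show "move4 i (move4 i q) = q"
      using generator_cases4[OF i]
    proof (elim disjE)
      assume "i = 2"
      then show ?thesis by (simp only: move4_2 swap4_swap4)
    qed (cases q; simp)+
    show "label4 i (move4 i q) \<otimes>\<^bsub>free_group {1..7}\<^esub> label4 i q = \<one>\<^bsub>free_group {1..7}\<^esub>"
      by (cases "i = 2") (simp_all add: move4_2 label4_swap4 one del: One_nat_def)
  next
    fix i j :: nat and q
    assume "i \<in> {1..4 - 1}" "j \<in> {1..4 - 1}" "\<bar>int i - int j\<bar> \<ge> 2"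
    \<comment> \<open>With three generators, s_1 and s_3 form the only commuting pair, and both have
      trivial labels.\<close>
    then have ij: "i = 1 \<and> j = 3 \<or> i = 3 \<and> j = 1" by auto
    then show "move4 i (move4 j q) = move4 j (move4 i q)" by (cases q) auto
    show "label4 i (move4 j q) \<otimes>\<^bsub>free_group {1..7}\<^esub> label4 j q
        = label4 j (move4 i q) \<otimes>\<^bsub>free_group {1..7}\<^esub> label4 i q"
      using ij by (elim disjE) (simp_all add: one del: One_nat_def)
  next
    \<comment> \<open>Each free generator occurs as the label of its own edge, so the labels
      generate.\<close>
    have gen: "presented_gen {1..7} {} k = label4 2 (source4 k)" if "k \<in> {1..7}" for k
      using that by (simp add: presented_gen_def label4_def edge4_source4)
    have "presented_gen {1..7} {} ` {1..7} \<subseteq> {label4 i q |i q. i \<in> {1..4 - 1}}"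
    proof (rule image_subsetI)
      fix k :: nat assume "k \<in> {1..7}"
      moreover have "(2::nat) \<in> {1..4 - 1}" by simp
      ultimately show "presented_gen {1..7} {} k \<in> {label4 i q |i q. i \<in> {1..4 - 1}}"
        using gen by blast
    qed
    then show "carrier (free_group {1..7}) \<subseteq> generate (free_group {1..7}) {label4 i q |i q. i \<in> {1..4 - 1}}"
      unfolding free_group_def
      by (subst presented_group_generate) (rule group.mono_generate[OF group_presented_group])
  next
    fix q :: state4 and f assume f: "f \<in> carrier (free_group {1..7::nat})"
    have tree: "label4 2 p = \<one>\<^bsub>free_group {1..7}\<^esub>" if "edge4 p = []" for p
      using that by (simp add: label4_def free_group_def presented_one)
    let ?step = "\<lambda>i (p, g). (move4 i p, label4 i p \<otimes>\<^bsub>free_group {1..7}\<^esub> g)"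
    obtain a b v where q: "q = (a, b, v)" by (cases q)
    \<comment> \<open>Vertex words use only tree edges and letters other than 2, so every label met
      on the way is trivial.\<close>
    have "foldr ?step (vertex_word4 v) ((False, False, V12), f) = ((False, False, v), f)"
      using f by (cases v) (simp_all add: one tree del: One_nat_def)
    then show "foldr ?step (word4 q) ((False, False, V12), f) = (q, f)"
      using f by (simp add: q one del: One_nat_def)
  next
    show "word4 (False, False, V12) = []" by simp
  qed (rule group_free_group label4_closed psi4_hom word4_letters | erule step4 word4_perm_step word4_perm_inj)+
qed

section \<open>Three strands: the triangle\<close>

text \<open>The coset of \<open>p\<close> modulo \<open>\<langle>s\<^sub>1\<rangle>\<close> is named after the preimage of \<open>3\<close> under \<open>p\<close>; a state \<open>(a, v)\<close> stands
  for \<open>s\<^sub>1\<^sup>a\<close> times the chosen representative of \<open>v\<close>.\<close>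

datatype vertex3 = P1 | P2 | P3

type_synonym state3 = "bool \<times> vertex3"

fun swap3 :: "state3 \<Rightarrow> state3" where
  "swap3 (False, P3) = (False, P2)" |
  "swap3 (True, P3) = (False, P1)" |
  "swap3 (False, P2) = (False, P3)" |
  "swap3 (True, P2) = (True, P1)" |
  "swap3 (False, P1) = (True, P3)" |
  "swap3 (True, P1) = (True, P2)"

text \<open>Two of the three edges form the tree; the remaining one joins \<open>(True, P2)\<close>
  to \<open>(True, P1)\<close> and generates the integers.\<close>

fun edge3 :: "state3 \<Rightarrow> int" where
  "edge3 (True, P2) = 1" |
  "edge3 (True, P1) = - 1" |
  "edge3 _ = 0"

fun vertex_word3 :: "vertex3 \<Rightarrow> nat list" where
  "vertex_word3 P3 = []" |
  "vertex_word3 P2 = [2]" |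
  "vertex_word3 P1 = [2, 1]"

fun word3 :: "state3 \<Rightarrow> nat list" where
  "word3 (a, v) = (if a then [1] else []) @ vertex_word3 v"

fun move3 :: "nat \<Rightarrow> state3 \<Rightarrow> state3" where
  "move3 i (a, v) = (if i = 1 then (\<not> a, v) else swap3 (a, v))"

definition label3 :: "nat \<Rightarrow> state3 \<Rightarrow> int" where
  "label3 i q = (if i = 1 then 0 else edge3 q)"

text \<open>This element equals (s_1 s_2)^3: it compares s_1 s_2 s_1 with s_2 s_1 s_2, the two sides
  of the braid relation.\<close>

definition loop3 :: "nat gword set" where
  "loop3 = inv\<^bsub>twin_group 3\<^esub> twin_elt 3 (word3 (True, P1)) \<otimes>\<^bsub>twin_group 3\<^esub>
    twin_elt 3 (2 # word3 (True, P2))"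

lemma word3_letters: "set (word3 q) \<subseteq> {1..3 - 1}"
  by (cases q rule: swap3.cases) auto

lemma loop3_closed: "loop3 \<in> carrier (twin_group 3)"
proof -
  interpret T: group "twin_group 3" by (rule group_twin_group)
  show ?thesis unfolding loop3_def
    by (intro T.m_closed T.inv_closed twin_elt_closed) (use word3_letters in auto)
qed

lemma generator_cases3: "i \<in> {1..3 - 1::nat} \<Longrightarrow> i = 1 \<or> i = 2"
  by auto

lemma step3:
  assumes "i \<in> {1..3 - 1}"
  shows "twin_elt 3 (i # word3 q)
    = twin_elt 3 (word3 (move3 i q)) \<otimes>\<^bsub>twin_group 3\<^esub> loop3 [^]\<^bsub>twin_group 3\<^esub> label3 i q"
proof -
  interpret T: group "twin_group 3" by (rule group_twin_group)
  have closed': "twin_elt 3 (word3 p) \<in> carrier (twin_group 3)" for p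
    using word3_letters by (rule twin_elt_closed)
  have s: "twin_gen 3 2 \<in> carrier (twin_group 3)"
      "twin_gen 3 2 \<otimes>\<^bsub>twin_group 3\<^esub> twin_gen 3 2 = \<one>\<^bsub>twin_group 3\<^esub>"
    by (auto intro!: twin_gen_closed twin_gen_involution)
  note closed = twin_gen_closed[of _ 3] and cancel = twin_gen_cancel[of _ 3]
  \<comment> \<open>The only edge with nonzero label, crossed in both directions.\<close>
  have edge: "twin_elt 3 (2 # word3 (True, P2)) = twin_elt 3 (word3 (True, P1)) \<otimes>\<^bsub>twin_group 3\<^esub> loop3"
    "twin_elt 3 (2 # word3 (True, P1)) = twin_elt 3 (word3 (True, P2)) \<otimes>\<^bsub>twin_group 3\<^esub> inv\<^bsub>twin_group 3\<^esub> loop3"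
    using T.involution_edge(1)[OF s closed' closed', of "(True, P1)" "(True, P2)"]
      T.involution_edge(2)[OF s closed' closed', of "(True, P2)" "(True, P1)"]
    by (simp_all add: loop3_def del: word3.simps)
  show ?thesis
  proof (cases "label3 i q = 0")
    case True
    then show ?thesis
      using generator_cases3[OF assms]
      by (cases q rule: swap3.cases) (auto simp: label3_def closed cancel twin_gen_involution[of _ 3])
  next
    case False
    then have "i = 2" "q = (True, P1) \<or> q = (True, P2)"
      using generator_cases3[OF assms]
      by (auto simp: label3_def) (cases q rule: swap3.cases; simp)
    then show ?thesis using edge loop3_closed
      by (auto simp: label3_def T.int_pow_neg simp del: word3.simps twin_elt_simps)
  qed
qed

lemma word3_perm_inj:
  assumes "word_perm (word3 q) = id"
  shows "q = (False, P3)"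
proof -
  have "word_perm (word3 q) 1 = 1" "word_perm (word3 q) 2 = 2"
    using assms by auto
  then show ?thesis
    by (cases q rule: swap3.cases) (simp_all add: transpose_def)
qed

text \<open>On the edge outside the tree this is the braid relation, which holds in S_3 but not in
  T_3; hence the check on points.\<close>

lemma word3_perm_step:
  assumes "i \<in> {1..3 - 1}"
  shows "word_perm (i # word3 q) = word_perm (word3 (move3 i q))"
proof (rule word_perm_eqI)
  fix x :: nat assume "x \<in> {1..3}"
  then have "x = 1 \<or> x = 2 \<or> x = 3" by auto
  with generator_cases3[OF assms] show "word_perm (i # word3 q) x = word_perm (word3 (move3 i q)) x"
    by (cases q rule: swap3.cases) (elim disjE; simp add: transpose_def)+
qed (use assms word3_letters in \<open>auto simp del: word3.simps\<close>)

lemma pure_twin_group_3: "pure_twin_group 3 \<cong> integer_group"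
proof (rule twin_covering.pure_twin_group_iso)
  interpret T: group "twin_group 3" by (rule group_twin_group)
  show "twin_covering integer_group 3 move3 label3 (False, P3) word3 (\<lambda>k. loop3 [^]\<^bsub>twin_group 3\<^esub> k)"
  proof (intro twin_covering.intro twin_covering_axioms.intro)
    fix i q assume i: "i \<in> {1..3 - 1::nat}"
    show "move3 i (move3 i q) = q"
      using generator_cases3[OF i] by (cases q rule: swap3.cases) auto
    show "label3 i (move3 i q) \<otimes>\<^bsub>integer_group\<^esub> label3 i q = \<one>\<^bsub>integer_group\<^esub>"
      using generator_cases3[OF i] by (cases q rule: swap3.cases) (auto simp: label3_def)
  next
    \<comment> \<open>The edge outside the tree supplies the label 1, whose multiples are all
      integers.\<close>
    have "1 \<in> {label3 i q |i q. i \<in> {1..3 - 1::nat}}"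
      by (auto simp: label3_def intro!: exI[of _ "2::nat"] exI[of _ True] exI[of _ P2])
    then have "generate integer_group {1} \<subseteq> generate integer_group {label3 i q |i q. i \<in> {1..3 - 1::nat}}"
      by (intro group.mono_generate[OF group_integer_group]) auto
    then show "carrier integer_group \<subseteq> generate integer_group {label3 i q |i q. i \<in> {1..3 - 1::nat}}"
      by (simp add: group.generate_pow[OF group_integer_group] full_SetCompr_eq)
  next
    fix q f
    show "foldr (\<lambda>i (p, g). (move3 i p, label3 i p \<otimes>\<^bsub>integer_group\<^esub> g)) (word3 q) ((False, P3), f) = (q, f)"
      by (cases q rule: swap3.cases) (auto simp: label3_def)
  next
    show "(\<lambda>k. loop3 [^]\<^bsub>twin_group 3\<^esub> k) \<in> hom integer_group (twin_group 3)"
      by (rule T.hom_integer_group_pow[OF loop3_closed])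
  next
    fix i j :: nat and q
    assume "i \<in> {1..3 - 1}" "j \<in> {1..3 - 1}" "\<bar>int i - int j\<bar> \<ge> 2"
    \<comment> \<open>The indices 1 and 2 never differ by 2, so T_3 has no commutation relations to
      verify.\<close>
    then have False by auto
    then show "move3 i (move3 j q) = move3 j (move3 i q)"
      "label3 i (move3 j q) \<otimes>\<^bsub>integer_group\<^esub> label3 j q
        = label3 j (move3 i q) \<otimes>\<^bsub>integer_group\<^esub> label3 i q" by auto
  next
    show "word3 (False, P3) = []" by simp
    show "label3 i q \<in> carrier integer_group" for i q by simp
  qed (rule group_integer_group word3_letters | erule step3 word3_perm_step word3_perm_inj)+
qed

theorem theorem3p1:
  shows "pure_twin_group 3 \<cong> integer_group \<and> pure_twin_group 4 \<cong> free_group {1..7::nat}"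
  using pure_twin_group_3 pure_twin_group_4 ..

end
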